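(* Consider the MI-NEP of the context. Suppose that Assumption A (with constants $\alpha\in[0,1)$ and $\mathbf w\in\mathbb R^N$, $w_\nu>0$) and Assumption B (with constant $\beta>0$) hold, and that $\max_{\nu\in\mathcal I}\sqrt{i_\nu}>0$. Let $\varepsilon\ge0$ and let $\{\mathbf x^k\}_{k\in\mathbb N}\subseteq\Omega$ be a sequence generated by the inexact Jacobi-type best-response method with accuracy $\varepsilon$ and index sets $\{\mathcal J^k\}_{k\in\mathbb N}$; assume that there is an integer $h\ge1$ such that $\nu\in\bigcup_{t=k}^{k+h-1}\mathcal J^t$ for every player $\nu\in\mathcal I$ and every iteration $k$. Let $\mathcal S$ be the (possibly empty) set of equilibria of the MI-NEP. (i) For every $\gamma\in(1,1/\alpha)$ and every $\mathbf x^*\in\mathcal S$, the method generates a point $\mathbf x^k$ such that $$\max_{\nu\in\mathcal I} w_\nu\|x^{k,\nu}-x^{*,\nu}\| < \left(\frac{\gamma}{1-\gamma\alpha}\right)\max_{\nu\in\mathcal I}w_\nu(2\beta\sqrt{i_\nu}+\varepsilon)\qquad(\star)$$ after at most $\overline k_\gamma$ iterations, where $$\overline k_\gamma := h\left\lceil \log_\gamma\left(\max\left\{\frac{(1-\gamma\alpha)\max_{\mathbf z^*\in\mathcal S,\,\nu\in\mathcal I}w_\nu\|x^{0,\nu}-z^{*,\nu}\|}{\max_{\nu\in\mathcal I}w_\nu(2\beta\sqrt{i_\nu}+\varepsilon)},\ \gamma\right\}\right)\right\rceil .$$ (ii) For every $\gamma\in(1,1/\alpha)$ and every $\mathbf x^*\in\mathcal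 S$, any point $\mathbf x^k$ with $k\ge\overline k_\gamma$ satisfies $(\star)$. (iii) Assume that $\Omega$ is bounded or $\mathcal S$ is nonempty. Then $\{\mathbf x^k\}_{k\in\mathbb N}$ has at least one cluster point, and every cluster point $\widetilde{\mathbf x}$ is contained in $\Omega$ and satisfies, for every $\mathbf x^*\in\mathcal S$, $$\max_{\nu\in\mathcal I}w_\nu\|\widetilde x^\nu-x^{*,\nu}\|\le \left(\frac{1}{1-\alpha}\right)\max_{\nu\in\mathcal I}w_\nu(2\beta\sqrt{i_\nu}+\varepsilon).$$
   Context: MI-NEP (mixed-integer Nash equilibrium problem). There are $N$ players, $\mathcal I=\{1,\dots,N\}$. Player $\nu$ controls $x^\nu\in\mathbb R^{n_\nu}$; $\mathbf x=(x^\nu)_{\nu\in\mathcal I}\in\mathbb R^n$, $n=\sum_\nu n_\nu$; $\mathbf x^{-\nu}$ collects the strategies of all players other than $\nu$, and one writes $\mathbf x=(x^\nu,\mathbf x^{-\nu})$. Given $\mathbf x^{-\nu}$, player $\nu$ solves $$\min_{x^\nu}\ \theta_\nu(x^\nu,\mathbf x^{-\nu})\quad\text{s.t. } x^\nu\in\Omega_\nu:=\{x^\nu\in X_\nu \mid x^\nu_j\in\mathbb Z,\ j=1,\dots,i_\nu\},$$ where $\theta_\nu:\mathbb R^n\to\mathbb R$ is continuously differentiable and convex with respect to $x^\nu$, $X_\nu\subseteq\mathbb R^{n_\nu}$ is closed and convex (possibly unbounded), $0\le i_\nu\le n_\nu$ is an integer, and $\Omega_\nu\neq\emptyset$. Put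 $\Omega=\prod_\nu\Omega_\nu$, $X=\prod_\nu X_\nu$, $\Omega_{-\nu}=\prod_{\nu'\ne\nu}\Omega_{\nu'}$. Standing assumption: each player's problem has a solution for every given $\mathbf x^{-\nu}$. Best responses: $R_\nu(\mathbf x^{-\nu})=\arg\min\{\theta_\nu(x^\nu,\mathbf x^{-\nu}) : x^\nu\in\Omega_\nu\}$ (mixed-integer) and $T_\nu(\mathbf x^{-\nu})=\arg\min\{\theta_\nu(x^\nu,\mathbf x^{-\nu}) : x^\nu\in X_\nu\}$ (continuous). It is assumed throughout that $T=(T_\nu)_\nu$ is single-valued on $X$. Equilibrium of the MI-NEP: $\overline{\mathbf x}\in\Omega$ such that $\overline x^\nu\in R_\nu(\overline{\mathbf x}^{-\nu})$ for all $\nu\in\mathcal I$. $\|\cdot\|$ is any given norm. Assumption A: there exist $\alpha\in[0,1)$ and $\mathbf w\in\mathbb R^N$ with $w_\nu>0$ for all $\nu$ such that for all $\mathbf z,\mathbf y\in X$: $\max_{\nu}w_\nu\|T_\nu(\mathbf z^{-\nu})-T_\nu(\mathbf y^{-\nu})\|\le\alpha\max_\nu w_\nu\|z^\nu-y^\nu\|$. Assumption B: there exists $\beta>0$ such that for all $\nu\in\mathcal I$ and $\mathbf z^{-\nu}\in\Omega_{-\nu}$: $\|\widehat x^\nu-T_\nu(\mathbf z^{-\nu})\|\le\beta\sqrt{i_\nu}$ for all $\widehat x^\nu\in R_\nu(\mathbf z^{-\nu})$. Inexact Jacobi-type best-response method with accuracy $\varepsilon$: start from $\mathbf x^0\in\Omega$;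 at each iteration $k=0,1,\dots$ select a subset $\mathcal J^k\subseteq\mathcal I$; for $\nu\in\mathcal J^k$ choose any $x^{k+1,\nu}\in\Omega_\nu$ such that $\|x^{k+1,\nu}-\widetilde x^{k,\nu}\|\le\varepsilon$ for some $\widetilde x^{k,\nu}\in R_\nu(\mathbf x^{k,-\nu})$; for $\nu\notin\mathcal J^k$ set $x^{k+1,\nu}=x^{k,\nu}$. Convention: $1/\alpha=+\infty$ if $\alpha=0$. Items (i) and (ii) are vacuous when $\mathcal S=\emptyset$. *)

theory Defs
  imports "HOL-Analysis.Analysis"
begin

text \<open>
  The players are the elements of a finite type \<open>'p\<close>, and the \<open>n\<close> scalar variables of the game are
  indexed by a finite type \<open>'c\<close>, so that strategy profiles are vectors in \<open>real ^ 'c\<close>.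
  The \<open>j\<close>-th variable of player \<open>\<nu>\<close> (\<open>1 \<le> j \<le> nvars G \<nu>\<close>) is the coordinate \<open>coord G \<nu> j\<close>.
  As the dimensions \<open>nvars G \<nu>\<close> may differ between players, the strategy space of player \<open>\<nu>\<close> is
  realised inside \<open>real ^ 'c\<close>, as the subspace of vectors that vanish outside the coordinates
  of \<open>\<nu>\<close>; likewise, a tuple of rivals' strategies is a vector that vanishes on these coordinates.
\<close>

record ('p, 'c) game =
  nvars :: "'p \<Rightarrow> nat"
  nints :: "'p \<Rightarrow> nat"
  coord :: "'p \<Rightarrow> nat \<Rightarrow> 'c"
  cset  :: "'p \<Rightarrow> (real ^ 'c) set"
  cost  :: "'p \<Rightarrow> real ^ 'c \<Rightarrow> real"

definition coords :: "('p, 'c::finite) game \<Rightarrow> 'p \<Rightarrow> 'c set" where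
  "coords G \<nu> = coord G \<nu> ` {1..nvars G \<nu>}"

definition strategies :: "('p, 'c::finite) game \<Rightarrow> 'p \<Rightarrow> (real ^ 'c) set" where
  "strategies G \<nu> = {y. \<forall>c. c \<notin> coords G \<nu> \<longrightarrow> y $ c = 0}"

definition rival_strategies :: "('p, 'c::finite) game \<Rightarrow> 'p \<Rightarrow> (real ^ 'c) set" where
  "rival_strategies G \<nu> = {r. \<forall>c\<in>coords G \<nu>. r $ c = 0}"

definition own :: "('p, 'c::finite) game \<Rightarrow> 'p \<Rightarrow> real ^ 'c \<Rightarrow> real ^ 'c" where
  "own G \<nu> x = (\<chi> c. if c \<in> coords G \<nu> then x $ c else 0)"

definition rivals :: "('p, 'c::finite) game \<Rightarrow> 'p \<Rightarrow> real ^ 'c \<Rightarrow> real ^ 'c" where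
  "rivals G \<nu> x = (\<chi> c. if c \<in> coords G \<nu> then 0 else x $ c)"

definition join :: "('p, 'c::finite) game \<Rightarrow> 'p \<Rightarrow> real ^ 'c \<Rightarrow> real ^ 'c \<Rightarrow> real ^ 'c" where
  "join G \<nu> y r = (\<chi> c. if c \<in> coords G \<nu> then y $ c else r $ c)"

definition mi_set :: "('p, 'c::finite) game \<Rightarrow> 'p \<Rightarrow> (real ^ 'c) set" where
  "mi_set G \<nu> = {y \<in> cset G \<nu>. \<forall>j\<in>{1..nints G \<nu>}. y $ coord G \<nu> j \<in> \<int>}"

definition profiles_X :: "('p, 'c::finite) game \<Rightarrow> (real ^ 'c) set" where
  "profiles_X G = {x. \<forall>\<nu>. own G \<nu> x \<in> cset G \<nu>}"

definition profiles_Omega :: "('p, 'c::finite) game \<Rightarrow> (real ^ 'c) set" where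
  "profiles_Omega G = {x. \<forall>\<nu>. own G \<nu> x \<in> mi_set G \<nu>}"

definition rivals_Omega :: "('p, 'c::finite) game \<Rightarrow> 'p \<Rightarrow> (real ^ 'c) set" where
  "rivals_Omega G \<nu> = {r \<in> rival_strategies G \<nu>. \<forall>\<mu>. \<mu> \<noteq> \<nu> \<longrightarrow> own G \<mu> r \<in> mi_set G \<mu>}"

definition mi_best_responses :: "('p, 'c::finite) game \<Rightarrow> 'p \<Rightarrow> real ^ 'c \<Rightarrow> (real ^ 'c) set" where
  "mi_best_responses G \<nu> r =
     {y. is_arg_min (\<lambda>y. cost G \<nu> (join G \<nu> y r)) (\<lambda>y. y \<in> mi_set G \<nu>) y}"

definition cont_best_responses :: "('p, 'c::finite) game \<Rightarrow> 'p \<Rightarrow> real ^ 'c \<Rightarrow> (real ^ 'c) set" where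
  "cont_best_responses G \<nu> r =
     {y. is_arg_min (\<lambda>y. cost G \<nu> (join G \<nu> y r)) (\<lambda>y. y \<in> cset G \<nu>) y}"

text \<open>Meaningful only where the continuous best response is unique.\<close>

definition cont_best_response :: "('p, 'c::finite) game \<Rightarrow> 'p \<Rightarrow> real ^ 'c \<Rightarrow> real ^ 'c" where
  "cont_best_response G \<nu> r = (THE y. y \<in> cont_best_responses G \<nu> r)"

definition equilibria :: "('p, 'c::finite) game \<Rightarrow> (real ^ 'c) set" where
  "equilibria G =
     {x \<in> profiles_Omega G. \<forall>\<nu>. own G \<nu> x \<in> mi_best_responses G \<nu> (rivals G \<nu> x)}"

definition continuously_differentiable :: "('a::real_normed_vector \<Rightarrow> real) \<Rightarrow> bool" where
  "continuously_differentiable f \<longleftrightarrow>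
     (\<exists>D :: 'a \<Rightarrow> 'a \<Rightarrow>\<^sub>L real.
        (\<forall>x. (f has_derivative blinfun_apply (D x)) (at x)) \<and> continuous_on UNIV D)"

text \<open>The first condition says that the coordinates of the players partition those of \<open>real ^ 'c\<close>.\<close>

definition mi_nep :: "('p, 'c::finite) game \<Rightarrow> bool" where
  "mi_nep G \<longleftrightarrow>
     bij_betw (\<lambda>(\<nu>, j). coord G \<nu> j) (SIGMA \<nu>:UNIV. {1..nvars G \<nu>}) UNIV \<and>
     (\<forall>\<nu>. nints G \<nu> \<le> nvars G \<nu> \<and>
          cset G \<nu> \<subseteq> strategies G \<nu> \<and> closed (cset G \<nu>) \<and> convex (cset G \<nu>) \<and>
          mi_set G \<nu> \<noteq> {} \<and>
          continuously_differentiable (cost G \<nu>) \<and>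
          (\<forall>r\<in>rival_strategies G \<nu>.
             convex_on (strategies G \<nu>) (\<lambda>y. cost G \<nu> (join G \<nu> y r)) \<and>
             mi_best_responses G \<nu> r \<noteq> {}))"

definition cont_single_valued :: "('p, 'c::finite) game \<Rightarrow> bool" where
  "cont_single_valued G \<longleftrightarrow>
     (\<forall>x\<in>profiles_X G. \<forall>\<nu>. \<exists>!y. y \<in> cont_best_responses G \<nu> (rivals G \<nu> x))"

definition norm_on :: "'a::real_vector set \<Rightarrow> ('a \<Rightarrow> real) \<Rightarrow> bool" where
  "norm_on V f \<longleftrightarrow>
     (\<forall>x\<in>V. f x \<ge> 0 \<and> (f x = 0 \<longleftrightarrow> x = 0)) \<and>
     (\<forall>x\<in>V. \<forall>a. f (a *\<^sub>R x) = \<bar>a\<bar> * f x) \<and>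
     (\<forall>x\<in>V. \<forall>y\<in>V. f (x + y) \<le> f x + f y)"

text \<open>
  \<open>nrm \<nu>\<close> is the norm on the strategy space of player \<open>\<nu>\<close>; only its values there matter.
\<close>

definition wdist ::
  "('p::finite, 'c::finite) game \<Rightarrow> ('p \<Rightarrow> real ^ 'c \<Rightarrow> real) \<Rightarrow> ('p \<Rightarrow> real) \<Rightarrow>
   real ^ 'c \<Rightarrow> real ^ 'c \<Rightarrow> real" where
  "wdist G nrm w x y = (MAX \<nu>. w \<nu> * nrm \<nu> (own G \<nu> x - own G \<nu> y))"

definition assumption_A ::
  "('p::finite, 'c::finite) game \<Rightarrow> ('p \<Rightarrow> real ^ 'c \<Rightarrow> real) \<Rightarrow> real \<Rightarrow> ('p \<Rightarrow> real) \<Rightarrow> bool" where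
  "assumption_A G nrm \<alpha> w \<longleftrightarrow>
     0 \<le> \<alpha> \<and> \<alpha> < 1 \<and> (\<forall>\<nu>. w \<nu> > 0) \<and>
     (\<forall>z\<in>profiles_X G. \<forall>y\<in>profiles_X G.
        (MAX \<nu>. w \<nu> * nrm \<nu> (cont_best_response G \<nu> (rivals G \<nu> z)
                             - cont_best_response G \<nu> (rivals G \<nu> y)))
          \<le> \<alpha> * wdist G nrm w z y)"

definition assumption_B ::
  "('p, 'c::finite) game \<Rightarrow> ('p \<Rightarrow> real ^ 'c \<Rightarrow> real) \<Rightarrow> real \<Rightarrow> bool" where
  "assumption_B G nrm \<beta> \<longleftrightarrow>
     \<beta> > 0 \<and>
     (\<forall>\<nu>. \<forall>r\<in>rivals_Omega G \<nu>. \<forall>y\<in>mi_best_responses G \<nu> r.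
        nrm \<nu> (y - cont_best_response G \<nu> r) \<le> \<beta> * sqrt (real (nints G \<nu>)))"

definition inexact_jacobi ::
  "('p, 'c::finite) game \<Rightarrow> ('p \<Rightarrow> real ^ 'c \<Rightarrow> real) \<Rightarrow> real \<Rightarrow>
   (nat \<Rightarrow> 'p set) \<Rightarrow> (nat \<Rightarrow> real ^ 'c) \<Rightarrow> bool" where
  "inexact_jacobi G nrm \<epsilon> J x \<longleftrightarrow>
     x 0 \<in> profiles_Omega G \<and>
     (\<forall>k. \<forall>\<nu>\<in>J k. own G \<nu> (x (Suc k)) \<in> mi_set G \<nu> \<and>
        (\<exists>y\<in>mi_best_responses G \<nu> (rivals G \<nu> (x k)). nrm \<nu> (own G \<nu> (x (Suc k)) - y) \<le> \<epsilon>)) \<and>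
     (\<forall>k. \<forall>\<nu>. \<nu> \<notin> J k \<longrightarrow> own G \<nu> (x (Suc k)) = own G \<nu> (x k))"

definition error_level ::
  "('p::finite, 'c::finite) game \<Rightarrow> ('p \<Rightarrow> real) \<Rightarrow> real \<Rightarrow> real \<Rightarrow> real" where
  "error_level G w \<beta> \<epsilon> = (MAX \<nu>. w \<nu> * (2 * \<beta> * sqrt (real (nints G \<nu>)) + \<epsilon>))"

text \<open>
  The set of equilibria may be infinite, so the maximum over it is written as a supremum; under
  assumptions A and B this set is compact, hence the supremum is attained if the set is nonempty.
  The logarithm is at least \<open>1\<close> for \<open>\<gamma> > 1\<close>, so \<open>nat\<close> does not truncate.
\<close>

definition iteration_bound ::
  "('p::finite, 'c::finite) game \<Rightarrow> ('p \<Rightarrow> real ^ 'c \<Rightarrow> real) \<Rightarrow> real \<Rightarrow> ('p \<Rightarrow> real) \<Rightarrow> real \<Rightarrow>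
   real \<Rightarrow> nat \<Rightarrow> real ^ 'c \<Rightarrow> real \<Rightarrow> nat" where
  "iteration_bound G nrm \<alpha> w \<beta> \<epsilon> h x0 \<gamma> =
     h * nat \<lceil>log \<gamma> (max ((1 - \<gamma> * \<alpha>) * (SUP z\<in>equilibria G. wdist G nrm w x0 z)
                            / error_level G w \<beta> \<epsilon>) \<gamma>)\<rceil>"

definition cluster_point :: "(nat \<Rightarrow> 'a::topological_space) \<Rightarrow> 'a \<Rightarrow> bool" where
  "cluster_point x l \<longleftrightarrow> (\<exists>r. strict_mono r \<and> (x \<circ> r) \<longlonglongrightarrow> l)"

end

theory Submission
  imports Defs
begin

text \<open>
  Fix an equilibrium \<open>x*\<close> and let \<open>c\<close> be the error level. By assumptions A and B and the triangle
  inequality, a player who updates at step \<open>k\<close> ends up at weighted distance at most \<open>c + \<alpha> D k\<close>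
  from \<open>x*\<close>, where \<open>D k\<close> is the weighted distance of \<open>x k\<close> from \<open>x*\<close>; the others do not move.
  Every player updates once in \<open>h\<close> consecutive steps, so each block of \<open>h\<close> steps turns a bound
  \<open>M \<ge> c / (1 - \<alpha>)\<close> on \<open>D\<close> into the bound \<open>c + \<alpha> M\<close>. As long as \<open>M \<ge> \<gamma> c / (1 - \<gamma> \<alpha>)\<close>, this is a
  reduction at least by the factor \<open>\<gamma>\<close>.
\<close>

text \<open>Players update at different times within a window, so \<open>M j\<close> is claimed for
  all times from \<open>j * h\<close> on: whichever step of the next block a player uses, all
  players already obey \<open>M j\<close>, and the update brings it below \<open>M (Suc j)\<close>.
  In the base case, \<open>decr\<close> keeps every update below \<open>M 0\<close>.\<close>

lemma block_contraction:
  fixes d :: "nat \<Rightarrow> 'p \<Rightarrow> real" and M :: "nat \<Rightarrow> real"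
  assumes upd: "\<And>k \<nu> B. \<nu> \<in> J k \<Longrightarrow> (\<And>\<mu>. d k \<mu> \<le> B) \<Longrightarrow> d (Suc k) \<nu> \<le> c + \<alpha> * B"
    and idle: "\<And>k \<nu>. \<nu> \<notin> J k \<Longrightarrow> d (Suc k) \<nu> = d k \<nu>"
    and window: "\<And>\<nu> k. \<nu> \<in> (\<Union>t\<in>{k..k + h - 1}. J t)"
    and h: "h \<ge> 1"
    and init: "\<And>\<nu>. d 0 \<nu> \<le> M 0"
    and step: "\<And>j. c + \<alpha> * M j \<le> M (Suc j)"
    and decr: "M (Suc 0) \<le> M 0"
    and k: "k \<ge> j * h"
  shows "d k \<nu> \<le> M j"
  using k
proof (induction j arbitrary: k \<nu>)
  case 0
  show ?case
  proof (induction k arbitrary: \<nu>)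
    case 0
    show ?case by (rule init)
  next
    case (Suc k)
    show ?case
    proof (cases "\<nu> \<in> J k")
      case True
      from upd[OF True Suc.IH] step[of 0] decr show ?thesis by linarith
    next
      case False
      with idle Suc.IH show ?thesis by simp
    qed
  qed
next
  case (Suc j)
  obtain t where t: "j * h \<le> t" "t \<le> j * h + h - 1" "\<nu> \<in> J t"
    using window[of \<nu> "j * h"] by auto
  have fresh: "d (Suc s) \<nu> \<le> M (Suc j)" if "j * h \<le> s" "\<nu> \<in> J s" for s
  proof -
    have "d (Suc s) \<nu> \<le> c + \<alpha> * M j"
      using that Suc.IH by (intro upd) auto
    with step[of j] show ?thesis by linarith
  qed
  \<comment> \<open>The window starting at \<open>j * h\<close> ends at
    \<open>j * h + h - 1\<close>, so the update is visible at time \<open>j * h + h\<close> at the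
    latest.\<close>
  have "Suc t \<le> k"
    using t h Suc.prems by simp
  \<comment> \<open>After this update, every later step either leaves the player's value unchanged
    or renews the bound through \<open>fresh\<close>.\<close>
  then show ?case
  proof (induction k rule: dec_induct)
    case base
    show ?case using fresh t by simp
  next
    case (step n)
    show ?case
    proof (cases "\<nu> \<in> J n")
      case True
      with step.hyps t show ?thesis by (intro fresh) auto
    next
      case False
      with idle step.IH show ?thesis by simp
    qed
  qed
qed

section \<open>Coordinate blocks of the players and feasible sets\<close>

lemma own_in_strategies: "own G \<nu> x \<in> strategies G \<nu>"
  by (simp add: own_def strategies_def)

lemma own_diff: "own G \<nu> (x - y) = own G \<nu> x - own G \<nu> y"
  by (simp add: own_def vec_eq_iff)

lemma linear_own: "linear (own G \<nu>)"
  by (rule linearI) (auto simp: own_def vec_eq_iff)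

lemma strategies_diff:
  "x \<in> strategies G \<nu> \<Longrightarrow> y \<in> strategies G \<nu> \<Longrightarrow> x - y \<in> strategies G \<nu>"
  by (simp add: strategies_def)

text \<open>The blocks cover all coordinates because the numbering is surjective, and they are
  disjoint because it is injective.\<close>

lemma mi_nep_coords:
  assumes "mi_nep G"
  shows "\<exists>\<nu>. c \<in> coords G \<nu>"
    and "c \<in> coords G \<nu> \<Longrightarrow> c \<in> coords G \<mu> \<Longrightarrow> \<mu> = \<nu>"
proof -
  have bij: "bij_betw (\<lambda>(\<nu>, j). coord G \<nu> j) (SIGMA \<nu>:UNIV. {1..nvars G \<nu>}) UNIV"
    using assms by (simp add: mi_nep_def)
  then have "c \<in> (\<lambda>(\<nu>, j). coord G \<nu> j) ` (SIGMA \<nu>:UNIV. {1..nvars G \<nu>})"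
    by (simp add: bij_betw_def)
  then show "\<exists>\<nu>. c \<in> coords G \<nu>"
    by (auto simp: coords_def)
  assume "c \<in> coords G \<nu>" "c \<in> coords G \<mu>"
  then obtain i j where ij: "c = coord G \<nu> i" "i \<in> {1..nvars G \<nu>}"
      "c = coord G \<mu> j" "j \<in> {1..nvars G \<mu>}"
    unfolding coords_def by blast
  have inj: "inj_on (\<lambda>(\<nu>, j). coord G \<nu> j) (SIGMA \<nu>:UNIV. {1..nvars G \<nu>})"
    using bij by (rule bij_betw_imp_inj_on)
  have "(\<mu>, j) = (\<nu>, i)"
    by (rule inj_onD[OF inj]) (use ij in auto)
  then show "\<mu> = \<nu>" by simp
qed

lemma own_all_zero_imp_zero:
  assumes "mi_nep G" "\<And>\<nu>. own G \<nu> x = 0"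
  shows "x = 0"
proof -
  have "x $ c = 0" for c
  proof -
    obtain \<nu> where "c \<in> coords G \<nu>"
      using mi_nep_coords(1)[OF assms(1)] by blast
    then have "x $ c = own G \<nu> x $ c" by (simp add: own_def)
    with assms(2) show ?thesis by simp
  qed
  then show ?thesis by (simp add: vec_eq_iff)
qed

lemma profiles_Omega_subset_X: "profiles_Omega G \<subseteq> profiles_X G"
  by (auto simp: profiles_Omega_def profiles_X_def mi_set_def)

lemma rivals_in_rival_strategies: "rivals G \<nu> x \<in> rival_strategies G \<nu>"
  by (simp add: rivals_def rival_strategies_def)

text \<open>Blanking the coordinates of \<open>\<nu>\<close> leaves the disjoint blocks of the
  others intact. This makes assumption B applicable at points of
  \<open>profiles_Omega\<close>.\<close>

lemma rivals_in_rivals_Omega: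
  assumes "mi_nep G" "x \<in> profiles_Omega G"
  shows "rivals G \<nu> x \<in> rivals_Omega G \<nu>"
proof -
  have "own G \<mu> (rivals G \<nu> x) = own G \<mu> x" if "\<mu> \<noteq> \<nu>" for \<mu>
    using mi_nep_coords(2)[OF assms(1), of _ \<nu> \<mu>] that
    by (auto simp: own_def rivals_def vec_eq_iff)
  with assms(2) show ?thesis
    by (simp add: rivals_Omega_def profiles_Omega_def rivals_in_rival_strategies)
qed

text \<open>Uniqueness gives the \<open>THE\<close> term its meaning. Membership in
  \<open>strategies\<close> matters because the norm laws for \<open>nrm \<nu>\<close> are available
  only there.\<close>

lemma cont_best_response_in_strategies:
  assumes "mi_nep G" "cont_single_valued G" "x \<in> profiles_X G"
  shows "cont_best_response G \<nu> (rivals G \<nu> x) \<in> strategies G \<nu>"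
proof -
  have "\<exists>!y. y \<in> cont_best_responses G \<nu> (rivals G \<nu> x)"
    using assms by (simp add: cont_single_valued_def)
  then have "cont_best_response G \<nu> (rivals G \<nu> x) \<in> cont_best_responses G \<nu> (rivals G \<nu> x)"
    unfolding cont_best_response_def by (rule theI')
  then have "cont_best_response G \<nu> (rivals G \<nu> x) \<in> cset G \<nu>"
    by (simp add: cont_best_responses_def is_arg_min_def)
  with assms(1) show ?thesis by (auto simp: mi_nep_def)
qed

lemma mi_best_responses_subset_strategies:
  assumes "mi_nep G"
  shows "mi_best_responses G \<nu> r \<subseteq> strategies G \<nu>"
  using assms by (auto simp: mi_best_responses_def is_arg_min_def mi_set_def mi_nep_def)

text \<open>The integers form a closed set, so each integrality constraint is a closed preimage
  under a coordinate map. This later places the cluster points in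
  \<open>profiles_Omega\<close>.\<close>

lemma closed_profiles_Omega:
  fixes G :: "('p::finite, 'c::finite) game"
  assumes "mi_nep G"
  shows "closed (profiles_Omega G)"
proof -
  have cont: "continuous_on UNIV (own G \<nu>)" for \<nu>
    by (rule linear_continuous_on_compose[OF continuous_on_id linear_own, simplified])
  have "closed (mi_set G \<nu>)" for \<nu>
  proof -
    have eq: "mi_set G \<nu> = cset G \<nu> \<inter> (\<Inter>j\<in>{1..nints G \<nu>}. (\<lambda>y. y $ coord G \<nu> j) -` \<int>)"
      by (auto simp: mi_set_def)
    have "closed ((\<lambda>y::real^'c. y $ coord G \<nu> j) -` \<int>)" for j
      by (rule closed_vimage[OF closed_Ints]) (intro continuous_intros)
    moreover have "closed (cset G \<nu>)"
      using assms by (simp add: mi_nep_def)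
    ultimately show ?thesis
      unfolding eq by (intro closed_Int closed_INT) auto
  qed
  then have "closed (own G \<nu> -` mi_set G \<nu>)" for \<nu>
    using cont by (intro closed_vimage)
  then have "closed (\<Inter>\<nu>. own G \<nu> -` mi_set G \<nu>)"
    by blast
  also have "(\<Inter>\<nu>. own G \<nu> -` mi_set G \<nu>) = profiles_Omega G"
    by (auto simp: profiles_Omega_def)
  finally show ?thesis .
qed

lemma cluster_point_in_closed:
  fixes l :: "'a::topological_space"
  assumes "cluster_point x l" "closed S" "\<And>k. x k \<in> S"
  shows "l \<in> S"
proof -
  obtain r where "(x \<circ> r) \<longlonglongrightarrow> l"
    using assms(1) by (auto simp: cluster_point_def)
  then show ?thesis
    by (rule closed_sequentially[OF assms(2), rotated]) (simp add: assms(3))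
qed

section \<open>Abstract norms on the strategy spaces and the Euclidean topology\<close>

lemma norm_onD:
  assumes "norm_on V f" "x \<in> V"
  shows norm_on_nonneg: "f x \<ge> 0"
    and norm_on_eq_0_iff: "f x = 0 \<longleftrightarrow> x = 0"
    and norm_on_scaleR: "f (a *\<^sub>R x) = \<bar>a\<bar> * f x"
    and norm_on_triangle: "y \<in> V \<Longrightarrow> f (x + y) \<le> f x + f y"
  using assms by (auto simp: norm_on_def)

lemma norm_on_minus:
  assumes "norm_on V f" "x \<in> V"
  shows "f (- x) = f x"
  using norm_on_scaleR[OF assms, of "-1"] by simp

text \<open>The norm axioms make the composition with the linear map \<open>own G \<nu>\<close>
  convex, and a real convex function on a finite-dimensional space is continuous.\<close>

lemma norm_on_own_continuous:
  fixes G :: "('p, 'c::finite) game"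
  assumes "norm_on (strategies G \<nu>) (nrm \<nu>)"
  shows "continuous_on UNIV (\<lambda>x. nrm \<nu> (own G \<nu> x))"
proof (rule convex_on_continuous)
  show "convex_on UNIV (\<lambda>x. nrm \<nu> (own G \<nu> x))"
  proof (rule convex_onI)
    fix t :: real and x y :: "real ^ 'c"
    assume t: "0 < t" "t < 1"
    have "nrm \<nu> (own G \<nu> ((1 - t) *\<^sub>R x + t *\<^sub>R y))
        = nrm \<nu> (own G \<nu> ((1 - t) *\<^sub>R x) + own G \<nu> (t *\<^sub>R y))"
      by (simp add: linear_add[OF linear_own])
    also have "\<dots> \<le> nrm \<nu> (own G \<nu> ((1 - t) *\<^sub>R x)) + nrm \<nu> (own G \<nu> (t *\<^sub>R y))"
      by (intro norm_on_triangle[OF assms] own_in_strategies)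
    also have "nrm \<nu> (own G \<nu> (s *\<^sub>R z)) = \<bar>s\<bar> * nrm \<nu> (own G \<nu> z)" for s z
      by (simp add: linear_cmul[OF linear_own] norm_on_scaleR[OF assms own_in_strategies])
    then have "nrm \<nu> (own G \<nu> ((1 - t) *\<^sub>R x)) + nrm \<nu> (own G \<nu> (t *\<^sub>R y))
        = (1 - t) * nrm \<nu> (own G \<nu> x) + t * nrm \<nu> (own G \<nu> y)"
      using t by simp
    finally show "nrm \<nu> (own G \<nu> ((1 - t) *\<^sub>R x + t *\<^sub>R y))
        \<le> (1 - t) * nrm \<nu> (own G \<nu> x) + t * nrm \<nu> (own G \<nu> y)" .
  qed simp
qed simp

text \<open>Equivalence of norms: the sum of the players' norms vanishes only at zero, as the blocks
  cover all coordinates, and therefore dominates a positive multiple of the Euclidean norm.\<close>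

lemma bounded_if_players_bounded:
  fixes G :: "('p::finite, 'c::finite) game"
  assumes nep: "mi_nep G"
    and nrm: "\<And>\<nu>. norm_on (strategies G \<nu>) (nrm \<nu>)"
    and bnd: "\<And>k \<nu>. nrm \<nu> (own G \<nu> (x k)) \<le> B"
  shows "bounded (range x)"
proof -
  define p where "p = (\<lambda>x. \<Sum>\<nu>\<in>UNIV. nrm \<nu> (own G \<nu> x))"
  have nonneg: "0 \<le> nrm \<nu> (own G \<nu> x)" for \<nu> x
    by (rule norm_on_nonneg[OF nrm own_in_strategies])
  have zero: "nrm \<nu> (own G \<nu> x) = 0 \<longleftrightarrow> own G \<nu> x = 0" for \<nu> x
    by (rule norm_on_eq_0_iff[OF nrm own_in_strategies])
  have homog: "p (s *\<^sub>R z) = \<bar>s\<bar> * p z" for s z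
  proof -
    have "nrm \<nu> (own G \<nu> (s *\<^sub>R z)) = \<bar>s\<bar> * nrm \<nu> (own G \<nu> z)" for \<nu>
      by (simp add: linear_cmul[OF linear_own] norm_on_scaleR[OF nrm own_in_strategies])
    then show ?thesis by (simp add: p_def sum_distrib_left)
  qed
  have "p z \<ge> 0" for z
    unfolding p_def using nonneg by (intro sum_nonneg)
  moreover have "p z \<noteq> 0" if "z \<noteq> 0" for z
  proof -
    obtain \<nu> where "own G \<nu> z \<noteq> 0"
      using \<open>z \<noteq> 0\<close> own_all_zero_imp_zero[OF nep] by blast
    with nonneg zero show ?thesis
      by (auto simp: p_def sum_nonneg_eq_0_iff)
  qed
  ultimately have pos: "p z > 0" if "z \<noteq> 0" for z
    using that by (metis less_le)
  have "continuous_on UNIV p"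
    unfolding p_def by (intro continuous_on_sum norm_on_own_continuous nrm)
  moreover have "sphere 0 1 \<noteq> ({} :: (real ^ 'c) set)"
    by simp
  \<comment> \<open>The comparison constant is the minimum of \<open>p\<close> on the unit sphere;
    being attained, it is positive.\<close>
  ultimately obtain u where u: "u \<in> sphere 0 1" "\<And>z. z \<in> sphere 0 1 \<Longrightarrow> p u \<le> p z"
    using continuous_attains_inf[OF compact_sphere, of 0 1 p] continuous_on_subset
    by (metis subset_UNIV)
  from u(1) have pu: "p u > 0" by (intro pos) auto
  have "norm (x k) \<le> CARD('p) * B / p u" for k
  proof -
    have "p u * norm z \<le> p z" for z
    proof (cases "z = 0")
      case True
      then show ?thesis using homog[of 0 z] by simp
    next
      case False
      then have "p u \<le> p ((1 / norm z) *\<^sub>R z)" by (intro u) simp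
      with False show ?thesis by (simp add: homog field_simps)
    qed
    also have "p (x k) \<le> (\<Sum>\<nu>\<in>(UNIV :: 'p set). B)"
      unfolding p_def by (intro sum_mono bnd)
    finally show ?thesis using pu by (simp add: field_simps)
  qed
  then show ?thesis by (auto intro: boundedI)
qed

section \<open>The weighted maximum distance and the one-step estimate\<close>

lemma wdist_le_iff:
  "wdist G nrm w x y \<le> B \<longleftrightarrow> (\<forall>\<nu>. w \<nu> * nrm \<nu> (own G \<nu> x - own G \<nu> y) \<le> B)"
  by (auto simp: wdist_def)

lemma wdist_triangle:
  assumes nrm: "\<And>\<nu>. norm_on (strategies G \<nu>) (nrm \<nu>)" and w: "\<And>\<nu>. w \<nu> > 0"
  shows "wdist G nrm w x z \<le> wdist G nrm w x y + wdist G nrm w y z"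
  unfolding wdist_le_iff[of G nrm w x z]
proof
  fix \<nu>
  let ?d = "\<lambda>x y. nrm \<nu> (own G \<nu> x - own G \<nu> y)"
  have "?d x z = nrm \<nu> ((own G \<nu> x - own G \<nu> y) + (own G \<nu> y - own G \<nu> z))" by simp
  also have "\<dots> \<le> ?d x y + ?d y z"
    by (intro norm_on_triangle[OF nrm] strategies_diff own_in_strategies)
  finally have "w \<nu> * ?d x z \<le> w \<nu> * ?d x y + w \<nu> * ?d y z"
    using w[of \<nu>] by (metis distrib_left mult_le_cancel_left_pos)
  also have "\<dots> \<le> wdist G nrm w x y + wdist G nrm w y z"
    by (intro add_mono) (auto simp: wdist_def)
  finally show "w \<nu> * ?d x z \<le> wdist G nrm w x y + wdist G nrm w y z" .
qed

text \<open>The path from \<open>v\<close> to \<open>own G \<nu> xs\<close> runs through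
  \<open>y\<close> and the continuous best responses to \<open>x\<close> and \<open>xs\<close>. Its
  four legs are controlled by \<open>\<epsilon>\<close>, B, A and B, whence the factor 2 in the
  error level. A free \<open>v\<close> covers both a new iterate and, with \<open>v = y\<close>, the
  component of another equilibrium.\<close>

lemma mi_best_response_dist:
  fixes G :: "('p::finite, 'c::finite) game"
  assumes nep: "mi_nep G" and sv: "cont_single_valued G"
    and nrm: "\<And>\<nu>. norm_on (strategies G \<nu>) (nrm \<nu>)"
    and A: "assumption_A G nrm \<alpha> w" and B: "assumption_B G nrm \<beta>"
    and x: "x \<in> profiles_Omega G" and xs: "xs \<in> equilibria G"
    and y: "y \<in> mi_best_responses G \<nu> (rivals G \<nu> x)"
    and v: "v \<in> strategies G \<nu>" "nrm \<nu> (v - y) \<le> \<epsilon>"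
  shows "w \<nu> * nrm \<nu> (v - own G \<nu> xs) \<le> error_level G w \<beta> \<epsilon> + \<alpha> * wdist G nrm w x xs"
proof -
  let ?V = "strategies G \<nu>"
  define T where "T = (\<lambda>z. cont_best_response G \<nu> (rivals G \<nu> z))"
  have xsO: "xs \<in> profiles_Omega G"
    and xsR: "own G \<nu> xs \<in> mi_best_responses G \<nu> (rivals G \<nu> xs)"
    using xs by (auto simp: equilibria_def)
  have X: "x \<in> profiles_X G" "xs \<in> profiles_X G"
    using x xsO profiles_Omega_subset_X by auto
  have w: "w \<nu> > 0" using A by (simp add: assumption_A_def)
  have TV: "T x \<in> ?V" "T xs \<in> ?V"
    unfolding T_def using cont_best_response_in_strategies[OF nep sv] X by auto
  have yV: "y \<in> ?V"
    using y mi_best_responses_subset_strategies[OF nep] by blast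
  have xsV: "own G \<nu> xs \<in> ?V" by (rule own_in_strategies)
  have tri: "nrm \<nu> (a + b) \<le> nrm \<nu> a + nrm \<nu> b" if "a \<in> ?V" "b \<in> ?V" for a b
    using that by (rule norm_on_triangle[OF nrm])
  have tri': "nrm \<nu> (a - c) \<le> nrm \<nu> (a - b) + nrm \<nu> (b - c)"
    if "a \<in> ?V" "b \<in> ?V" "c \<in> ?V" for a b c
    using tri[of "a - b" "b - c"] that by (simp add: strategies_diff)
  have B1: "nrm \<nu> (y - T x) \<le> \<beta> * sqrt (nints G \<nu>)"
    using B rivals_in_rivals_Omega[OF nep x] y unfolding assumption_B_def T_def by blast
  have "nrm \<nu> (own G \<nu> xs - T xs) \<le> \<beta> * sqrt (nints G \<nu>)"
    using B rivals_in_rivals_Omega[OF nep xsO] xsR unfolding assumption_B_def T_def by blast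
  then have B2: "nrm \<nu> (T xs - own G \<nu> xs) \<le> \<beta> * sqrt (nints G \<nu>)"
    using norm_on_minus[OF nrm strategies_diff[OF TV(2) xsV]] by simp
  have "(MAX \<mu>. w \<mu> * nrm \<mu> (cont_best_response G \<mu> (rivals G \<mu> x)
      - cont_best_response G \<mu> (rivals G \<mu> xs))) \<le> \<alpha> * wdist G nrm w x xs"
    using A X by (simp add: assumption_A_def)
  then have A1: "w \<nu> * nrm \<nu> (T x - T xs) \<le> \<alpha> * wdist G nrm w x xs"
    by (simp add: T_def)
  have "nrm \<nu> (v - own G \<nu> xs) \<le> nrm \<nu> (v - y) + nrm \<nu> (y - own G \<nu> xs)"
    using v yV xsV by (intro tri')
  also have "nrm \<nu> (y - own G \<nu> xs) \<le> nrm \<nu> (y - T x) + nrm \<nu> (T x - own G \<nu> xs)"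
    using TV yV xsV by (intro tri')
  also have "nrm \<nu> (T x - own G \<nu> xs) \<le> nrm \<nu> (T x - T xs) + nrm \<nu> (T xs - own G \<nu> xs)"
    using TV xsV by (intro tri')
  finally have "nrm \<nu> (v - own G \<nu> xs) \<le> 2 * \<beta> * sqrt (nints G \<nu>) + \<epsilon> + nrm \<nu> (T x - T xs)"
    using B1 B2 v(2) by linarith
  then have "w \<nu> * nrm \<nu> (v - own G \<nu> xs)
      \<le> w \<nu> * (2 * \<beta> * sqrt (nints G \<nu>) + \<epsilon>) + w \<nu> * nrm \<nu> (T x - T xs)"
    using w by (metis distrib_left mult_le_cancel_left_pos)
  moreover have "w \<nu> * (2 * \<beta> * sqrt (nints G \<nu>) + \<epsilon>) \<le> error_level G w \<beta> \<epsilon>"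
    unfolding error_level_def by (intro Max_ge) auto
  ultimately show ?thesis using A1 by linarith
qed

section \<open>Convergence of the inexact Jacobi iterates\<close>

theorem mainTheorem6:
  fixes G :: "('p::finite, 'c::finite) game"
    and nrm :: "'p \<Rightarrow> real ^ 'c \<Rightarrow> real"
    and \<alpha> \<beta> \<epsilon> :: real
    and w :: "'p \<Rightarrow> real"
    and J :: "nat \<Rightarrow> 'p set"
    and x :: "nat \<Rightarrow> real ^ 'c"
    and h :: nat
  assumes "mi_nep G"
    and "cont_single_valued G"
    and "\<And>\<nu>. norm_on (strategies G \<nu>) (nrm \<nu>)"
    and "assumption_A G nrm \<alpha> w"
    and "assumption_B G nrm \<beta>"
    and "(MAX \<nu>. sqrt (real (nints G \<nu>))) > 0"
    and "\<epsilon> \<ge> 0"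
    and "inexact_jacobi G nrm \<epsilon> J x"
    and "h \<ge> 1"
    and "\<And>\<nu> k. \<nu> \<in> (\<Union>t\<in>{k..k + h - 1}. J t)"
  shows
    "(\<forall>\<gamma>. 1 < \<gamma> \<and> (\<alpha> = 0 \<or> \<gamma> < 1 / \<alpha>) \<longrightarrow>
        (\<forall>xs\<in>equilibria G. \<exists>k \<le> iteration_bound G nrm \<alpha> w \<beta> \<epsilon> h (x 0) \<gamma>.
           wdist G nrm w (x k) xs < \<gamma> / (1 - \<gamma> * \<alpha>) * error_level G w \<beta> \<epsilon>)) \<and>
     (\<forall>\<gamma>. 1 < \<gamma> \<and> (\<alpha> = 0 \<or> \<gamma> < 1 / \<alpha>) \<longrightarrow>
        (\<forall>xs\<in>equilibria G. \<forall>k \<ge> iteration_bound G nrm \<alpha> w \<beta> \<epsilon> h (x 0) \<gamma>.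
           wdist G nrm w (x k) xs < \<gamma> / (1 - \<gamma> * \<alpha>) * error_level G w \<beta> \<epsilon>)) \<and>
     (bounded (profiles_Omega G) \<or> equilibria G \<noteq> {} \<longrightarrow>
        (\<exists>xt. cluster_point x xt) \<and>
        (\<forall>xt. cluster_point x xt \<longrightarrow>
           xt \<in> profiles_Omega G \<and>
           (\<forall>xs\<in>equilibria G. wdist G nrm w xt xs \<le> 1 / (1 - \<alpha>) * error_level G w \<beta> \<epsilon>)))"
proof -
  let ?D = "wdist G nrm w"
  let ?c = "error_level G w \<beta> \<epsilon>"
  let ?O = "profiles_Omega G"
  \<comment> \<open>Distances are kept per player: inside a block only some players have been
    updated, so the maximum alone would not carry the induction.\<close>
  define d where "d = (\<lambda>xs k \<nu>. w \<nu> * nrm \<nu> (own G \<nu> (x k) - own G \<nu> xs))"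
  have \<alpha>: "0 \<le> \<alpha>" "\<alpha> < 1" and w: "\<And>\<nu>. w \<nu> > 0"
    using assms(4) by (auto simp: assumption_A_def)
  have \<beta>: "\<beta> > 0" using assms(5) by (simp add: assumption_B_def)
  \<comment> \<open>Some player has an integer variable, and its term in the maximum is positive
    even for \<open>\<epsilon> = 0\<close>.\<close>
  have c: "?c > 0"
  proof -
    have "(MAX \<nu>. sqrt (nints G \<nu>)) \<in> range (\<lambda>\<nu>. sqrt (nints G \<nu>))"
      by (rule Max_in) auto
    then obtain \<nu> where "sqrt (nints G \<nu>) > 0" using assms(6) by force
    then have "0 < w \<nu> * (2 * \<beta> * sqrt (nints G \<nu>) + \<epsilon>)"
      using w[of \<nu>] \<beta> assms(7) by (intro mult_pos_pos add_pos_nonneg) auto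
    also have "\<dots> \<le> ?c" unfolding error_level_def by (intro Max_ge) auto
    finally show ?thesis .
  qed
  have xO: "x k \<in> ?O" for k
  proof (induction k)
    case 0
    show ?case using assms(8) by (simp add: inexact_jacobi_def)
  next
    case (Suc k)
    have "own G \<nu> (x (Suc k)) \<in> mi_set G \<nu>" for \<nu>
      using assms(8) Suc by (cases "\<nu> \<in> J k") (auto simp: inexact_jacobi_def profiles_Omega_def)
    then show ?case by (simp add: profiles_Omega_def)
  qed
  have upd: "d xs (Suc k) \<nu> \<le> ?c + \<alpha> * B"
    if xs: "xs \<in> equilibria G" and \<nu>: "\<nu> \<in> J k" and bnd: "\<And>\<mu>. d xs k \<mu> \<le> B" for xs k \<nu> B
  proof -
    obtain y where "y \<in> mi_best_responses G \<nu> (rivals G \<nu> (x k))"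
        "nrm \<nu> (own G \<nu> (x (Suc k)) - y) \<le> \<epsilon>"
      using assms(8) \<nu> unfolding inexact_jacobi_def by blast
    then have "d xs (Suc k) \<nu> \<le> ?c + \<alpha> * ?D (x k) xs"
      unfolding d_def
      by (intro mi_best_response_dist[OF assms(1-5) xO xs] own_in_strategies)
    moreover have "?D (x k) xs \<le> B"
      using bnd by (simp add: wdist_le_iff d_def)
    then have "\<alpha> * ?D (x k) xs \<le> \<alpha> * B" using \<alpha> by (intro mult_left_mono)
    ultimately show ?thesis by linarith
  qed
  have idle: "d xs (Suc k) \<nu> = d xs k \<nu>" if "\<nu> \<notin> J k" for xs k \<nu>
    using assms(8) that by (simp add: inexact_jacobi_def d_def)
  have contraction: "?D (x k) xs \<le> M j"
    if "xs \<in> equilibria G" "?D (x 0) xs \<le> M 0" "\<And>j. ?c + \<alpha> * M j \<le> M (Suc j)"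
      "M (Suc 0) \<le> M 0" "k \<ge> j * h" for xs M j k
  proof -
    have init: "d xs 0 \<nu> \<le> M 0" for \<nu>
      using that(2) by (simp add: wdist_le_iff d_def)
    have "d xs k \<nu> \<le> M j" for \<nu>
    proof (rule block_contraction[where J = J and c = ?c and \<alpha> = \<alpha> and h = h])
      show "d xs (Suc k) \<nu> \<le> ?c + \<alpha> * B" if "\<nu> \<in> J k" "\<And>\<mu>. d xs k \<mu> \<le> B" for k \<nu> B
        using upd[OF \<open>xs \<in> equilibria G\<close> that] .
    qed (fact idle assms(9,10) init that(3-5))+
    then show ?thesis by (simp add: wdist_le_iff d_def)
  qed
  have D_nonneg: "0 \<le> ?D y z" for y z
  proof -
    fix \<nu> :: 'p
    have "0 \<le> nrm \<nu> (own G \<nu> (y - z))"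
      by (rule norm_on_nonneg[OF assms(3) own_in_strategies])
    then have "0 \<le> w \<nu> * nrm \<nu> (own G \<nu> y - own G \<nu> z)"
      using w[of \<nu>] by (simp add: own_diff)
    also have "\<dots> \<le> ?D y z" unfolding wdist_def by (intro Max_ge) auto
    finally show ?thesis .
  qed
  \<comment> \<open>Each component of an equilibrium is an exact best response to the others, so the
    one-step estimate reads \<open>?D z xs \<le> ?c + \<alpha> * ?D z xs\<close>.\<close>
  have equilibria_close: "?D z xs \<le> ?c / (1 - \<alpha>)"
    if "z \<in> equilibria G" "xs \<in> equilibria G" for z xs
  proof -
    have "w \<nu> * nrm \<nu> (own G \<nu> z - own G \<nu> xs) \<le> ?c + \<alpha> * ?D z xs" for \<nu>
    proof (rule mi_best_response_dist[OF assms(1-5) _ that(2)])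
      show "z \<in> ?O" "own G \<nu> z \<in> mi_best_responses G \<nu> (rivals G \<nu> z)"
        using that(1) by (auto simp: equilibria_def)
      have "nrm \<nu> 0 = 0"
        using norm_on_eq_0_iff[OF assms(3), of 0 \<nu>] by (simp add: strategies_def)
      then show "nrm \<nu> (own G \<nu> z - own G \<nu> z) \<le> \<epsilon>" using assms(7) by simp
    qed (rule own_in_strategies)
    then have "?D z xs \<le> ?c + \<alpha> * ?D z xs" by (simp add: wdist_le_iff)
    with \<alpha> show ?thesis by (simp add: field_simps)
  qed
  \<comment> \<open>A real supremum is an upper bound only if the set is bounded above; here all
    equilibria lie within a fixed distance of any one of them.\<close>
  have bdd: "bdd_above ((\<lambda>z. ?D (x 0) z) ` equilibria G)"
  proof (cases "equilibria G = {}")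
    case False
    then obtain y where y: "y \<in> equilibria G" by blast
    have "?D (x 0) z \<le> ?D (x 0) y + ?c / (1 - \<alpha>)" if "z \<in> equilibria G" for z
    proof -
      have "?D (x 0) z \<le> ?D (x 0) y + ?D y z"
        by (rule wdist_triangle[OF assms(3) w])
      with equilibria_close[OF y that] show ?thesis by linarith
    qed
    then show ?thesis by (intro bdd_aboveI2)
  qed simp
  have ii: "?D (x k) xs < \<gamma> / (1 - \<gamma> * \<alpha>) * ?c"
    if \<gamma>: "1 < \<gamma>" "\<alpha> = 0 \<or> \<gamma> < 1 / \<alpha>" and xs: "xs \<in> equilibria G"
      and k: "k \<ge> iteration_bound G nrm \<alpha> w \<beta> \<epsilon> h (x 0) \<gamma>" for \<gamma> xs k
  proof -
    \<comment> \<open>As \<open>1 / 0 = 0\<close> in HOL, the convention for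
      \<open>\<alpha> = 0\<close> is a case of its own.\<close>
    have q: "1 - \<gamma> * \<alpha> > 0" using \<gamma> \<alpha> by (cases "\<alpha> = 0") (auto simp: field_simps)
    define D0 where "D0 = (SUP z\<in>equilibria G. ?D (x 0) z)"
    define b where "b = ?c / (1 - \<gamma> * \<alpha>)"
    \<comment> \<open>Decay by \<open>\<gamma>\<close> per block, floored at \<open>b\<close>, which
      solves \<open>?c + \<gamma> * \<alpha> * b = b\<close>. A bound above
      \<open>\<gamma> * b\<close> shrinks by the factor \<open>\<gamma>\<close> in one block; from a
      bound of at most \<open>\<gamma> * b\<close>, one block yields \<open>b\<close>.\<close>
    define M where "M = (\<lambda>j. max (D0 / \<gamma> ^ j) b)"
    define n where "n = nat \<lceil>log \<gamma> (max ((1 - \<gamma> * \<alpha>) * D0 / ?c) \<gamma>)\<rceil>"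
    have b: "b > 0" using c q by (simp add: b_def)
    have cb: "?c = (1 - \<gamma> * \<alpha>) * b" using q by (simp add: b_def)
    have D0: "?D (x 0) xs \<le> D0" unfolding D0_def by (rule cSUP_upper[OF xs bdd])
    have "?D (x k) xs \<le> M n"
    proof (rule contraction[OF xs])
      show "?D (x 0) xs \<le> M 0" using D0 by (simp add: M_def)
      have "D0 \<ge> 0" using D0 D_nonneg[of "x 0" xs] by linarith
      then have "D0 / \<gamma> \<le> D0" using \<gamma> by (simp add: divide_le_eq mult_le_cancel_left1)
      then show "M (Suc 0) \<le> M 0" by (auto simp: M_def)
      show "?c + \<alpha> * M j \<le> M (Suc j)" for j
      proof -
        have "b \<le> M (Suc j)" by (simp add: M_def)
        then have "?c \<le> (1 - \<gamma> * \<alpha>) * M (Suc j)"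
          unfolding cb using q by (intro mult_left_mono) auto
        moreover have "M j \<le> \<gamma> * M (Suc j)"
        proof -
          have "D0 / \<gamma> ^ j = \<gamma> * (D0 / \<gamma> ^ Suc j)" using \<gamma> by simp
          also have "\<dots> \<le> \<gamma> * M (Suc j)" unfolding M_def using \<gamma> by (intro mult_left_mono) auto
          finally have "D0 / \<gamma> ^ j \<le> \<gamma> * M (Suc j)" .
          moreover have "1 * b \<le> \<gamma> * M (Suc j)"
            using \<gamma> b \<open>b \<le> M (Suc j)\<close> by (intro mult_mono) auto
          ultimately show ?thesis by (simp add: M_def)
        qed
        then have "\<alpha> * M j \<le> \<alpha> * (\<gamma> * M (Suc j))" using \<alpha> by (intro mult_left_mono)
        ultimately show ?thesis by (simp add: algebra_simps)
      qed
      show "n * h \<le> k" using k by (simp add: iteration_bound_def n_def D0_def mult.commute)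
    qed
    \<comment> \<open>\<open>n\<close> counts the blocks after which the geometric term has dropped
      to the floor.\<close>
    also have "M n = b"
    proof -
      let ?m = "max ((1 - \<gamma> * \<alpha>) * D0 / ?c) \<gamma>"
      have "log \<gamma> ?m \<le> n" unfolding n_def by linarith
      then have "?m \<le> \<gamma> powr n" using \<gamma> by (subst (asm) log_le_iff) auto
      then have "(1 - \<gamma> * \<alpha>) * D0 / ?c \<le> \<gamma> ^ n" using \<gamma> by (simp add: powr_realpow)
      then have "D0 / \<gamma> ^ n \<le> b" using c q \<gamma> by (simp add: b_def field_simps)
      then show ?thesis by (simp add: M_def)
    qed
    \<comment> \<open>The strict inequality of the claim comes from this gap above the
      floor.\<close>
    also have "b < \<gamma> * b" using \<gamma> b by simp
    also have "\<gamma> * b = \<gamma> / (1 - \<gamma> * \<alpha>) * ?c" by (simp add: b_def)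
    finally show ?thesis .
  qed
  \<comment> \<open>Here the recursion holds with equality, around its fixed point
    \<open>?c / (1 - \<alpha>)\<close>. Starting from the fixed point plus the initial distance,
    rather than from that distance alone, makes the bounds nonincreasing.\<close>
  have decay: "?D (x k) xs \<le> ?c / (1 - \<alpha>) + \<alpha> ^ j * ?D (x 0) xs"
    if "xs \<in> equilibria G" "k \<ge> j * h" for xs j k
  proof (rule contraction[OF that(1) _ _ _ that(2)])
    show "?D (x 0) xs \<le> ?c / (1 - \<alpha>) + \<alpha> ^ 0 * ?D (x 0) xs" using c \<alpha> by simp
    show "?c + \<alpha> * (?c / (1 - \<alpha>) + \<alpha> ^ j * ?D (x 0) xs)
        \<le> ?c / (1 - \<alpha>) + \<alpha> ^ Suc j * ?D (x 0) xs" for j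
      using \<alpha> by (simp add: field_simps)
    show "?c / (1 - \<alpha>) + \<alpha> ^ Suc 0 * ?D (x 0) xs \<le> ?c / (1 - \<alpha>) + \<alpha> ^ 0 * ?D (x 0) xs"
      using \<alpha> D_nonneg[of "x 0" xs] by (simp add: mult_left_le_one_le)
  qed
  have iii_ex: "\<exists>xt. cluster_point x xt" if "bounded ?O \<or> equilibria G \<noteq> {}"
  proof -
    have "bounded (range x)"
    proof (cases "bounded ?O")
      case True
      then show ?thesis by (rule bounded_subset) (use xO in auto)
    next
      case False
      with that obtain xs where xs: "xs \<in> equilibria G" by blast
      define B where "B = ?c / (1 - \<alpha>) + ?D (x 0) xs"
      \<comment> \<open>The sum over all players replaces \<open>B / w \<nu>\<close> by a bound
        independent of \<open>\<nu>\<close>.\<close>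
      have "nrm \<nu> (own G \<nu> (x k - xs)) \<le> (\<Sum>\<mu>\<in>UNIV. B / w \<mu>)" for k \<nu>
      proof -
        have "?D (x k) xs \<le> B" using decay[OF xs, of 0 k] by (simp add: B_def)
        then have "w \<nu> * nrm \<nu> (own G \<nu> (x k - xs)) \<le> B" by (simp add: wdist_le_iff own_diff)
        then have "nrm \<nu> (own G \<nu> (x k - xs)) \<le> B / w \<nu>"
          using w[of \<nu>] by (simp add: field_simps)
        also have "B \<ge> 0" using c \<alpha> D_nonneg by (simp add: B_def)
        then have "B / w \<nu> \<le> (\<Sum>\<mu>\<in>UNIV. B / w \<mu>)"
          by (intro member_le_sum) (auto intro: divide_nonneg_pos w)
        finally show ?thesis .
      qed
      then have "bounded (range (\<lambda>k. x k - xs))"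
        by (rule bounded_if_players_bounded[OF assms(1,3)])
      then have "bounded ((\<lambda>y. xs + y) ` range (\<lambda>k. x k - xs))"
        by (rule bounded_translation)
      then show ?thesis by (simp add: image_image)
    qed
    then obtain l r where "strict_mono r" "(x \<circ> r) \<longlonglongrightarrow> l"
      using bounded_imp_convergent_subsequence by blast
    then show ?thesis by (auto simp: cluster_point_def)
  qed
  have iii_bound: "?D xt xs \<le> ?c / (1 - \<alpha>)"
    if xt: "cluster_point x xt" and xs: "xs \<in> equilibria G" for xt xs
    unfolding wdist_le_iff
  proof
    fix \<nu>
    obtain r where r: "strict_mono r" "(x \<circ> r) \<longlonglongrightarrow> xt"
      using xt by (auto simp: cluster_point_def)
    let ?f = "\<lambda>y. w \<nu> * nrm \<nu> (own G \<nu> (y - xs))"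
    have "continuous_on UNIV (\<lambda>y. nrm \<nu> (own G \<nu> (y - xs)))"
      by (rule continuous_on_compose2[OF norm_on_own_continuous[OF assms(3)]])
        (auto intro!: continuous_intros)
    then have "isCont ?f xt"
      by (intro continuous_intros) (simp add: continuous_on_eq_continuous_at)
    then have lim: "(\<lambda>n. ?f (x (r n))) \<longlonglongrightarrow> ?f xt"
      using r(2) by (intro isCont_tendsto_compose[of xt ?f]) (auto simp: o_def)
    \<comment> \<open>The limits are taken in turn: first along the subsequence for fixed
      \<open>j\<close>, using \<open>r n \<ge> n\<close>, and then in \<open>j\<close>, which
      removes the geometric term.\<close>
    have "?f xt \<le> ?c / (1 - \<alpha>) + \<alpha> ^ j * ?D (x 0) xs" for j
    proof (rule LIMSEQ_le_const2[OF lim], intro exI allI impI)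
      fix n assume "j * h \<le> n"
      then have "j * h \<le> r n" using seq_suble[OF r(1), of n] by linarith
      from decay[OF xs this] show "?f (x (r n)) \<le> ?c / (1 - \<alpha>) + \<alpha> ^ j * ?D (x 0) xs"
        by (simp add: wdist_le_iff own_diff)
    qed
    moreover have "(\<lambda>j. ?c / (1 - \<alpha>) + \<alpha> ^ j * ?D (x 0) xs) \<longlonglongrightarrow> ?c / (1 - \<alpha>) + 0 * ?D (x 0) xs"
      using \<alpha> by (intro tendsto_intros LIMSEQ_power_zero) auto
    ultimately have "?f xt \<le> ?c / (1 - \<alpha>) + 0 * ?D (x 0) xs"
      by (intro LIMSEQ_le_const) auto
    then show "w \<nu> * nrm \<nu> (own G \<nu> xt - own G \<nu> xs) \<le> ?c / (1 - \<alpha>)"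
      by (simp add: own_diff)
  qed
  have iii_Omega: "xt \<in> ?O" if "cluster_point x xt" for xt
    by (rule cluster_point_in_closed[OF that closed_profiles_Omega[OF assms(1)] xO])
  show ?thesis
  proof (intro conjI allI impI ballI)
    \<comment> \<open>Claim (i) is claim (ii) at the index \<open>iteration_bound\<close>
      itself.\<close>
    fix \<gamma> xs assume "1 < \<gamma> \<and> (\<alpha> = 0 \<or> \<gamma> < 1 / \<alpha>)" "xs \<in> equilibria G"
    then show "\<exists>k \<le> iteration_bound G nrm \<alpha> w \<beta> \<epsilon> h (x 0) \<gamma>.
        ?D (x k) xs < \<gamma> / (1 - \<gamma> * \<alpha>) * ?c"
      using ii by blast
  qed (use ii iii_ex iii_bound iii_Omega in auto)
qed

end
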